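(* Let $D\subseteq\mathbb{C}$ be open, let $\varphi_2$ be a polynomial of degree $2$, let $\varphi_1$ be a non-constant analytic function on $D$, let $\alpha,\beta\in\mathbb{R}^{+}\setminus\{1\}$, and for $n=0,1,2,\dots$ let $\Theta_n(x)=\alpha^{\varphi_1(x)}\frac{d^n}{dx^n}\beta^{-\varphi_2(x)}$. Then for each $n\geq 0$ the function $y=\Theta_n(x)$ satisfies on $D$ $$y''+\left\{\ln\beta\,\varphi_2'(x)-2\ln\alpha\,\varphi_1'(x)\right\}y'+\left\{(\ln\alpha)^2(\varphi_1'(x))^2-\ln\alpha\,\varphi_1''(x)-\ln\alpha\ln\beta\,\varphi_1'(x)\varphi_2'(x)+(n+1)\ln\beta\,\varphi_2''(x)\right\}y=0.$$
   Context: For $c>0$ and $w\in\mathbb{C}$, $c^{w}=e^{w\ln c}$ with $\ln$ the real natural logarithm. Primes denote derivatives with respect to $x$. *)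

theory Defs
  imports "HOL-Analysis.Analysis" "HOL-Computational_Algebra.Polynomial"
begin

(* Complex powr uses the principal logarithm, which on positive reals is the real logarithm. *)
lemma of_real_powr_complex:
  fixes c :: real and w :: complex
  assumes "c > 0"
  shows "complex_of_real c powr w = exp (w * complex_of_real (ln c))"
  using assms by (simp add: powr_def Ln_of_real)

definition Theta ::
    "real \<Rightarrow> real \<Rightarrow> (complex \<Rightarrow> complex) \<Rightarrow> complex poly \<Rightarrow> nat \<Rightarrow> complex \<Rightarrow> complex" where
  "Theta \<alpha> \<beta> \<phi>\<^sub>1 \<phi>\<^sub>2 n x =
     complex_of_real \<alpha> powr \<phi>\<^sub>1 x *
     (deriv ^^ n) (\<lambda>z. complex_of_real \<beta> powr (- poly \<phi>\<^sub>2 z)) x"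

end

theory Submission
  imports Defs "HOL-Complex_Analysis.Complex_Analysis"
begin

text \<open>With \<open>b = ln \<beta>\<close>, the function \<open>u = \<beta>\<^bsup>-\<phi>\<^sub>2\<^esup>\<close> solves the first-order equation
  \<open>u' = -b \<phi>\<^sub>2' u\<close>. Since \<open>\<phi>\<^sub>2'\<close> is linear, differentiating this equation \<open>n + 1\<close> times by the
  Leibniz rule leaves only two terms, so \<open>v = u\<^bsup>(n)\<^esup>\<close> satisfies
  \<open>v'' + b \<phi>\<^sub>2' v' + (n + 1) b \<phi>\<^sub>2'' v = 0\<close>. Substituting \<open>v = \<alpha>\<^bsup>-\<phi>\<^sub>1\<^esup> y\<close> gives the equation for \<open>y\<close>.\<close>

lemma deriv_poly: "deriv (poly p) = poly (pderiv p)"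
  for p :: "'a::real_normed_field poly"
  by (intro ext DERIV_imp_deriv poly_DERIV)

lemma has_field_derivative_higher_deriv:
  assumes "g holomorphic_on S" "open S" "z \<in> S"
  shows "((deriv ^^ n) g has_field_derivative (deriv ^^ Suc n) g z) (at z)"
  using holomorphic_derivI[OF holomorphic_higher_deriv[OF assms(1,2), of n] assms(2,3)] by simp

text \<open>The Leibniz rule enters as an induction on \<open>n\<close>: the case \<open>0\<close>
  is the equation differentiated once, and each further case differentiates the previous
  identity.\<close>

lemma higher_deriv_linear_coefficient:
  fixes g :: "complex \<Rightarrow> complex" and q :: "complex poly"
  assumes g: "g holomorphic_on UNIV"
    and ode: "\<And>z. deriv g z = poly q z * g z"
    and q: "degree q \<le> 1"
  shows "(deriv ^^ Suc (Suc n)) g z =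
    poly q z * (deriv ^^ Suc n) g z + of_nat (Suc n) * poly (pderiv q) z * (deriv ^^ n) g z"
proof (induction n arbitrary: z)
  have D: "((deriv ^^ k) g has_field_derivative (deriv ^^ Suc k) g z) (at z)" for k z
    using has_field_derivative_higher_deriv[OF g open_UNIV] by blast
  {
    case 0
    have "(deriv g has_field_derivative poly q z * deriv g z + poly (pderiv q) z * g z) (at z)"
      unfolding ode[abs_def]
      by (rule derivative_eq_intros poly_DERIV D[of 0, simplified] refl | simp add: ode)+
    then show ?case
      by (simp add: DERIV_imp_deriv)
  next
    case (Suc n)
    \<comment> \<open>The degree bound removes the term in \<open>(deriv ^^ n) g\<close>. The factor
      \<open>Suc (Suc n)\<close> collects one copy of \<open>pderiv q\<close> from the first product
      and \<open>Suc n\<close> copies from the second.\<close>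
    have "pderiv (pderiv q) = 0"
      using q by (simp add: pderiv_eq_0_iff degree_pderiv)
    then have "((\<lambda>z. poly q z * (deriv ^^ Suc n) g z
          + of_nat (Suc n) * poly (pderiv q) z * (deriv ^^ n) g z) has_field_derivative
        poly q z * (deriv ^^ Suc (Suc n)) g z
          + of_nat (Suc (Suc n)) * poly (pderiv q) z * (deriv ^^ Suc n) g z) (at z)"
      by (auto intro!: derivative_eq_intros poly_DERIV D simp del: funpow.simps
          simp: algebra_simps)
    then have "deriv ((deriv ^^ Suc (Suc n)) g) z = poly q z * (deriv ^^ Suc (Suc n)) g z
          + of_nat (Suc (Suc n)) * poly (pderiv q) z * (deriv ^^ Suc n) g z"
      using DERIV_imp_deriv Suc.IH[abs_def] by metis
    then show ?case
      by simp
  }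
qed

lemma deriv_exp_times:
  fixes f u :: "complex \<Rightarrow> complex"
  assumes "f holomorphic_on D" "u holomorphic_on D" "open D" "z \<in> D"
  shows "deriv (\<lambda>z. exp (c * f z) * u z) z = exp (c * f z) * (c * deriv f z * u z + deriv u z)"
  using holomorphic_derivI[OF assms(1,3,4)] holomorphic_derivI[OF assms(2,3,4)]
  by (auto intro!: DERIV_imp_deriv derivative_eq_intros simp: algebra_simps)

text \<open>The first derivative is again \<open>exp (c * f z)\<close> times a holomorphic factor,
  so \<open>deriv_exp_times\<close> applies a second time, with that factor in place of
  \<open>u\<close>.\<close>

lemma deriv_deriv_exp_times:
  fixes f u :: "complex \<Rightarrow> complex"
  assumes f: "f holomorphic_on D" and u: "u holomorphic_on D" and D: "open D" "z \<in> D"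
  shows "deriv (deriv (\<lambda>z. exp (c * f z) * u z)) z =
    exp (c * f z) * ((c\<^sup>2 * (deriv f z)\<^sup>2 + c * deriv (deriv f) z) * u z
      + 2 * c * deriv f z * deriv u z + deriv (deriv u) z)"
proof -
  have f': "deriv f holomorphic_on D" and u': "deriv u holomorphic_on D"
    using f u D by (auto intro: holomorphic_deriv)
  have "deriv (deriv (\<lambda>z. exp (c * f z) * u z)) z =
      deriv (\<lambda>z. exp (c * f z) * (c * deriv f z * u z + deriv u z)) z"
    \<comment> \<open>The first-derivative formula is known only on \<open>D\<close>; openness makes
      it valid near \<open>z\<close>, which suffices for differentiating it.\<close>
    using deriv_exp_times[OF f u D(1)] D
    by (intro deriv_cong_ev) (auto simp: eventually_nhds)
  also have "\<dots> = exp (c * f z) * (c * deriv f z * (c * deriv f z * u z + deriv u z)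
      + deriv (\<lambda>z. c * deriv f z * u z + deriv u z) z)"
    using f u f' u' D by (intro deriv_exp_times) (auto intro!: holomorphic_intros)
  also have "deriv (\<lambda>z. c * deriv f z * u z + deriv u z) z =
      c * deriv (deriv f) z * u z + c * deriv f z * deriv u z + deriv (deriv u) z"
    using f u f' u' D
    by (auto intro!: DERIV_imp_deriv derivative_eq_intros holomorphic_derivI[of _ D]
        simp: algebra_simps)
  finally show ?thesis
    by (simp add: algebra_simps power2_eq_square)
qed

theorem theorem5:
  fixes D :: "complex set"
    and \<phi>\<^sub>1 :: "complex \<Rightarrow> complex"
    and \<phi>\<^sub>2 :: "complex poly"
    and \<alpha> \<beta> :: real
    and n :: nat
  defines "y \<equiv> Theta \<alpha> \<beta> \<phi>\<^sub>1 \<phi>\<^sub>2 n"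
  assumes "open D"
    and "degree \<phi>\<^sub>2 = 2"
    and "\<phi>\<^sub>1 analytic_on D"
    and "\<not> \<phi>\<^sub>1 constant_on D"
    and "\<alpha> > 0" "\<alpha> \<noteq> 1"
    and "\<beta> > 0" "\<beta> \<noteq> 1"
  shows "y holomorphic_on D \<and>
    (\<forall>x\<in>D.
      deriv (deriv y) x
      + (of_real (ln \<beta>) * deriv (poly \<phi>\<^sub>2) x - 2 * of_real (ln \<alpha>) * deriv \<phi>\<^sub>1 x) * deriv y x
      + ((of_real (ln \<alpha>))\<^sup>2 * (deriv \<phi>\<^sub>1 x)\<^sup>2
         - of_real (ln \<alpha>) * deriv (deriv \<phi>\<^sub>1) x
         - of_real (ln \<alpha>) * of_real (ln \<beta>) * deriv \<phi>\<^sub>1 x * deriv (poly \<phi>\<^sub>2) x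
         + of_nat (n + 1) * of_real (ln \<beta>) * deriv (deriv (poly \<phi>\<^sub>2)) x) * y x = 0)"
proof -
  define a b :: complex where "a = of_real (ln \<alpha>)" and "b = of_real (ln \<beta>)"
  \<comment> \<open>Here \<open>g\<close> is \<beta> to the power
    \<open>- poly \<phi>\<^sub>2 z\<close>, an entire function, and \<open>u\<close> is its
    \<open>n\<close>-th derivative, called v in the overview.\<close>
  define g where "g = (\<lambda>z. exp (- b * poly \<phi>\<^sub>2 z))"
  define u where "u = (deriv ^^ n) g"
  \<comment> \<open>The logarithmic derivative of \<open>g\<close>.\<close>
  define q where "q = smult (- b) (pderiv \<phi>\<^sub>2)"
  have f: "\<phi>\<^sub>1 holomorphic_on D"
    using \<open>\<phi>\<^sub>1 analytic_on D\<close> by (rule analytic_imp_holomorphic)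
  have g: "g holomorphic_on UNIV"
    unfolding g_def by (intro holomorphic_intros)
  have u: "u holomorphic_on D"
    unfolding u_def by (rule holomorphic_on_subset[OF holomorphic_higher_deriv[OF g]]) auto
  have y: "y = (\<lambda>z. exp (a * \<phi>\<^sub>1 z) * u z)"
    using \<open>\<alpha> > 0\<close> \<open>\<beta> > 0\<close>
    by (simp add: y_def Theta_def[abs_def] of_real_powr_complex u_def g_def a_def b_def mult.commute)
  have "deriv g z = poly q z * g z" for z
    unfolding g_def q_def
    by (auto intro!: DERIV_imp_deriv derivative_eq_intros poly_DERIV)
  moreover have "degree q \<le> 1"
    using \<open>degree \<phi>\<^sub>2 = 2\<close> degree_smult_le[of "- b" "pderiv \<phi>\<^sub>2"] by (simp add: q_def degree_pderiv)
  ultimately have u_ode: "deriv (deriv u) z =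
      - b * poly (pderiv \<phi>\<^sub>2) z * deriv u z
      - of_nat (n + 1) * b * poly (pderiv (pderiv \<phi>\<^sub>2)) z * u z" for z
    using higher_deriv_linear_coefficient[OF g, of q n z]
    by (simp add: u_def q_def pderiv_smult pderiv_minus algebra_simps)
  have "y holomorphic_on D"
    unfolding y by (intro holomorphic_intros f u)
  then show ?thesis
    \<comment> \<open>After the common factor \<open>exp (a * \<phi>\<^sub>1 x)\<close> is taken
      out, all terms with derivatives of \<open>\<phi>\<^sub>1\<close> cancel, and
      \<open>u_ode\<close> is what remains.\<close>
    unfolding y a_def[symmetric] b_def[symmetric] deriv_poly
    by (auto simp: deriv_exp_times[OF f u \<open>open D\<close>] deriv_deriv_exp_times[OF f u \<open>open D\<close>] u_ode)
      (simp add: algebra_simps power2_eq_square)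
qed

end
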